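(* Let $r\ge2$ and let $\mathbb{RM}^{(r)}_n$ be an ordered $r$-matching chosen uniformly at random among all ordered $r$-matchings on $[rn]$. Then there is a constant $c>0$ depending only on $r$ such that, with probability tending to $1$ as $n\to\infty$, $\mathbb{RM}^{(r)}_n$ contains a line of size at least $cn^{1/r}$.
   Context: An ordered $r$-matching on $[rn]$ is a set of $n$ pairwise disjoint $r$-element subsets (edges) of $[rn]$ covering $[rn]$. A line of size $k$ in such a matching is a set of $k$ of its edges $e_1,\dots,e_k$ such that every vertex of $e_i$ is smaller than every vertex of $e_{i+1}$ for all $i<k$ (i.e. every pair of them forms the alignment pattern $A^rB^r$). *)

theory Defs
  imports "HOL-Probability.Probability"
begin

definition ordered_matchings :: "nat \<Rightarrow> nat \<Rightarrow> nat set set set" where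
  "ordered_matchings r n =
     {M. card M = n \<and> (\<forall>e\<in>M. card e = r) \<and> disjoint M \<and> \<Union>M = {1..r * n}}"

text \<open>The size of a line \<open>L\<close> is \<open>card L\<close>, which the distinct enumeration
  \<open>es\<close> makes equal to \<open>length es\<close>.\<close>

definition is_line :: "nat set set \<Rightarrow> nat set set \<Rightarrow> bool" where
  "is_line M L \<longleftrightarrow> L \<subseteq> M \<and>
     (\<exists>es. distinct es \<and> set es = L \<and>
        (\<forall>i. Suc i < length es \<longrightarrow> (\<forall>x\<in>es ! i. \<forall>y\<in>es ! Suc i. x < y)))"

text \<open>Finiteness and nonemptiness ensure that \<^term>\<open>pmf_of_set (ordered_matchings r n)\<close>
  is the uniform distribution; on infinite or empty sets it is unspecified.\<close>

lemma finite_ordered_matchings: "finite (ordered_matchings r n)"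
proof (rule finite_subset)
  show "ordered_matchings r n \<subseteq> Pow (Pow {1..r * n})"
    unfolding ordered_matchings_def by blast
qed simp

lemma ordered_matchings_nonempty:
  assumes "r > 0"
  shows "ordered_matchings r n \<noteq> {}"
proof -
  define B where "B i = {x \<in> {1..r * n}. (x - 1) div r = i}" for i
  have B_eq: "B i = {r * i + 1..r * i + r}" if "i < n" for i
  proof (rule set_eqI)
    fix x
    have le: "r * i + r \<le> r * n"
      using mult_le_mono2[of "Suc i" n r] that by simp
    have "(x - 1) div r = i \<longleftrightarrow> r * i \<le> x - 1 \<and> x - 1 < r * i + r"
      using assms div_nat_eqI[of r i "x - 1"] dividend_less_times_div[of r "x - 1"]
      by (auto simp: mult.commute add.commute)
    then have "x \<in> B i \<longleftrightarrow> 1 \<le> x \<and> x \<le> r * n \<and> r * i \<le> x - 1 \<and> x - 1 < r * i + r"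
      unfolding B_def by simp
    also have "\<dots> \<longleftrightarrow> x \<in> {r * i + 1..r * i + r}"
      unfolding atLeastAtMost_iff using le by linarith
    finally show "x \<in> B i \<longleftrightarrow> x \<in> {r * i + 1..r * i + r}" .
  qed
  have card_B: "card (B i) = r" if "i < n" for i
    using B_eq[OF that] by simp
  have disj: "B i \<inter> B j = {}" if "i \<noteq> j" for i j
    using that unfolding B_def by blast
  have inj: "inj_on B {..<n}"
  proof (rule inj_onI, rule ccontr)
    fix i j assume "i \<in> {..<n}" "B i = B j" "i \<noteq> j"
    then show False using disj[of i j] card_B[of i] assms by simp
  qed
  have "(x - 1) div r < n" if "x \<in> {1..r * n}" for x
  proof (rule less_mult_imp_div_less)
    show "x - 1 < n * r"
      using that unfolding atLeastAtMost_iff mult.commute[of n r] by linarith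
  qed
  then have cover: "\<Union>(B ` {..<n}) = {1..r * n}"
    unfolding B_def by auto
  have dis: "disjoint (B ` {..<n})"
    unfolding disjoint_def
  proof (intro ballI impI)
    fix S T assume "S \<in> B ` {..<n}" "T \<in> B ` {..<n}" "S \<noteq> T"
    then obtain i j where "S = B i" "T = B j" "i \<noteq> j" by blast
    then show "S \<inter> T = {}" using disj by simp
  qed
  have "card (B ` {..<n}) = n"
    using card_image[OF inj] by simp
  moreover have "\<forall>S\<in>B ` {..<n}. card S = r"
    using card_B by simp
  ultimately have "B ` {..<n} \<in> ordered_matchings r n"
    unfolding ordered_matchings_def using cover dis by simp
  then show ?thesis by blast
qed

end

theory Submission
  imports Defs "HOL-Real_Asymp.Real_Asymp"
begin

text \<open>Cut out about \<open>n\<^sup>1\<^sup>/\<^sup>r\<close> disjoint intervals (blocks) of length about \<open>n\<^sup>1\<^sup>-\<^sup>1\<^sup>/\<^sup>r\<close>. A given set of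
  \<open>k\<close> disjoint edges lies in a random matching with probability \<open>\<Prod>i<k. \<rho> (n - i)\<close>, where
  \<open>\<rho> n = 1 / (r n - 1 choose r - 1)\<close>, so the expected number \<open>\<mu>\<close> of edges inside one block is of
  constant order and at most \<open>1/2\<close>. By Chebyshev's inequality, the number \<open>X\<close> of edges inside
  blocks and the number \<open>Z\<close> of pairs of edges inside a common block are concentrated around
  their means, which are about \<open>m \<mu>\<close> and at most \<open>m \<mu>\<^sup>2 / 2\<close> for \<open>m\<close> blocks. One edge from each block
  containing an edge forms a line, of size at least \<open>X - Z\<close>, hence linear in \<open>m\<close>.\<close>

subsection \<open>Counting matchings that contain prescribed edges\<close>

text \<open>An arbitrary vertex set is allowed so that deleting the vertices of prescribed edges
  stays within the same class of objects.\<close>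

definition perfect_matchings :: "nat \<Rightarrow> nat set \<Rightarrow> nat set set set" where
  "perfect_matchings r V = {M. (\<forall>e\<in>M. card e = r) \<and> disjoint M \<and> \<Union>M = V}"

lemma finite_perfect_matchings: "finite V \<Longrightarrow> finite (perfect_matchings r V)"
  by (rule finite_subset[of _ "Pow (Pow V)"]) (auto simp: perfect_matchings_def)

text \<open>Counting vertices edge by edge gives \<open>r * n = card M * r\<close>, so for positive
  \<open>r\<close> the number of edges is forced to be \<open>n\<close>.\<close>

lemma ordered_matchings_eq_perfect_matchings:
  assumes "r > 0"
  shows "ordered_matchings r n = perfect_matchings r {1..r * n}"
proof -
  have "card M = n" if "\<forall>e\<in>M. card e = r" "disjoint M" "\<Union>M = {1..r * n}" for M
  proof -
    have "\<And>e. e \<in> M \<Longrightarrow> finite e"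
      using that assms by (metis card.infinite less_irrefl)
    then have "card (\<Union>M) = (\<Sum>e\<in>M. card e)"
      using that by (intro card_Union_disjoint) (auto simp: disjoint_def pairwise_def disjnt_def)
    then have "r * n = card M * r"
      using that by simp
    then show ?thesis using assms by simp
  qed
  then show ?thesis
    unfolding ordered_matchings_def perfect_matchings_def by blast
qed

text \<open>Deleting \<open>F\<close> from a matching that contains it leaves a perfect matching of
  the uncovered vertices, and adjoining \<open>F\<close> undoes this.\<close>

lemma perfect_matchings_containing:
  assumes "\<And>e. e \<in> F \<Longrightarrow> card e = r" "disjoint F" "\<Union>F \<subseteq> V"
  shows "{M \<in> perfect_matchings r V. F \<subseteq> M} = (\<lambda>M. M \<union> F) ` perfect_matchings r (V - \<Union>F)"
proof (intro equalityI subsetI)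
  fix M assume "M \<in> {M \<in> perfect_matchings r V. F \<subseteq> M}"
  then have M: "\<forall>e\<in>M. card e = r" "disjoint M" "\<Union>M = V" "F \<subseteq> M"
    by (auto simp: perfect_matchings_def)
  have "\<Union>(M - F) = V - \<Union>F"
  proof (intro equalityI subsetI)
    fix x assume "x \<in> \<Union>(M - F)"
    then obtain e where e: "e \<in> M" "e \<notin> F" "x \<in> e" by blast
    have "x \<notin> f" if "f \<in> F" for f
      using e that M(4) disjointD[OF M(2) e(1), of f] by blast
    then show "x \<in> V - \<Union>F" using e M(3) by blast
  qed (use M(3) in blast)
  then have "M - F \<in> perfect_matchings r (V - \<Union>F)"
    using M(1) pairwise_subset[OF M(2), of "M - F"] by (simp add: perfect_matchings_def)
  moreover have "M = (M - F) \<union> F" using M(4) by blast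
  ultimately show "M \<in> (\<lambda>M. M \<union> F) ` perfect_matchings r (V - \<Union>F)" by blast
next
  fix M' assume "M' \<in> (\<lambda>M. M \<union> F) ` perfect_matchings r (V - \<Union>F)"
  then obtain M where M: "M' = M \<union> F" "\<forall>e\<in>M. card e = r" "disjoint M" "\<Union>M = V - \<Union>F"
    by (auto simp: perfect_matchings_def)
  have "disjoint M'"
    unfolding M(1) using M assms by (intro disjoint_union) auto
  moreover have "\<Union>M' = V"
    using M assms by auto
  ultimately show "M' \<in> {M \<in> perfect_matchings r V. F \<subseteq> M}"
    using M assms by (auto simp: perfect_matchings_def)
qed

text \<open>Adjoining \<open>F\<close> is injective: an edge common to \<open>F\<close> and to a
  matching of \<open>V - \<Union>F\<close> would be empty, whereas edges have \<open>r > 0\<close>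
  elements.\<close>

lemma card_perfect_matchings_containing:
  assumes "r > 0" "\<And>e. e \<in> F \<Longrightarrow> card e = r" "disjoint F" "\<Union>F \<subseteq> V"
  shows "card {M \<in> perfect_matchings r V. F \<subseteq> M} = card (perfect_matchings r (V - \<Union>F))"
proof -
  have "inj_on (\<lambda>M. M \<union> F) (perfect_matchings r (V - \<Union>F))"
  proof (rule inj_onI)
    have disj: "M \<inter> F = {}" if "M \<in> perfect_matchings r (V - \<Union>F)" for M
    proof (rule ccontr)
      assume "M \<inter> F \<noteq> {}"
      then obtain e where "e \<in> M" "e \<in> F" by blast
      then have "e = {}" using that by (auto simp: perfect_matchings_def)
      then show False using assms(1,2) \<open>e \<in> F\<close> by fastforce
    qed
    fix M M' assume "M \<in> perfect_matchings r (V - \<Union>F)" "M' \<in> perfect_matchings r (V - \<Union>F)"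
      and "M \<union> F = M' \<union> F"
    then show "M = M'" using disj[of M] disj[of M'] by blast
  qed
  then show ?thesis
    using perfect_matchings_containing[of F r V] assms(2-4) by (simp add: card_image)
qed

section \<open>The number of perfect matchings\<close>

lemma card_subsets_containing:
  assumes "finite V" "v \<in> V" "r > 0"
  shows "card {e. e \<subseteq> V \<and> card e = r \<and> v \<in> e} = (card V - 1) choose (r - 1)"
proof -
  have "{e. e \<subseteq> V \<and> card e = r \<and> v \<in> e} = insert v ` {e. e \<subseteq> V - {v} \<and> card e = r - 1}"
  proof (intro equalityI subsetI)
    fix e assume e: "e \<in> {e. e \<subseteq> V \<and> card e = r \<and> v \<in> e}"
    then have "e = insert v (e - {v})" "e - {v} \<subseteq> V - {v}" "card (e - {v}) = r - 1"
      using assms by (auto simp: card_Diff_singleton)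
    then show "e \<in> insert v ` {e. e \<subseteq> V - {v} \<and> card e = r - 1}" by blast
  next
    fix e assume "e \<in> insert v ` {e. e \<subseteq> V - {v} \<and> card e = r - 1}"
    then obtain e' where e': "e = insert v e'" "e' \<subseteq> V - {v}" "card e' = r - 1" by blast
    have "finite e'" "v \<notin> e'" using e' assms finite_subset by auto
    then show "e \<in> {e. e \<subseteq> V \<and> card e = r \<and> v \<in> e}" using e' assms by auto
  qed
  moreover have "inj_on (insert v) {e. e \<subseteq> V - {v} \<and> card e = r - 1}"
    by (rule inj_onI) blast
  ultimately show ?thesis
    using assms by (simp add: card_image n_subsets)
qed

text \<open>Factor \<open>i\<close> counts the possible edges through a fixed vertex when
  \<open>i\<close> edges remain to be placed. For \<open>r > 0\<close> the product is the familiar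
  \<open>(rn)! / ((r!)^n n!)\<close>.\<close>

definition num_matchings :: "nat \<Rightarrow> nat \<Rightarrow> nat" where
  "num_matchings r n = (\<Prod>i = 1..n. (r * i - 1) choose (r - 1))"

lemma num_matchings_Suc:
  "num_matchings r (Suc n) = num_matchings r n * ((r * Suc n - 1) choose (r - 1))"
  by (simp add: num_matchings_def)

text \<open>Induction on the number of edges: matchings are classified by the unique edge covering a
  fixed vertex \<open>v\<close>, and each choice of that edge leaves \<open>r * n\<close> vertices
  to be matched.\<close>

lemma card_perfect_matchings:
  assumes "r > 0" "finite V" "card V = r * n"
  shows "card (perfect_matchings r V) = num_matchings r n"
  using assms(2,3)
proof (induction n arbitrary: V)
  case 0
  then have "V = {}" by simp
  have "M = {}" if "M \<in> perfect_matchings r V" for M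
  proof (rule ccontr)
    assume "M \<noteq> {}"
    then obtain e where "e \<in> M" by blast
    then have "e = {}" "card e = r"
      using that \<open>V = {}\<close> by (auto simp: perfect_matchings_def)
    then show False using assms(1) by simp
  qed
  then have "perfect_matchings r V = {{}}"
    using \<open>V = {}\<close> by (auto simp: perfect_matchings_def disjoint_def)
  then show ?case by (simp add: num_matchings_def)
next
  case (Suc n)
  have "V \<noteq> {}" using Suc.prems(2) assms(1) by auto
  then obtain v where v: "v \<in> V" by blast
  define S where "S = {e. e \<subseteq> V \<and> card e = r \<and> v \<in> e}"
  define P where "P e = {M \<in> perfect_matchings r V. {e} \<subseteq> M}" for e
  have "finite S"
    using Suc.prems(1) by (auto simp: S_def intro: finite_subset[of _ "Pow V"])
  have "perfect_matchings r V = (\<Union>e\<in>S. P e)"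
    using v by (auto simp: perfect_matchings_def S_def P_def)
  also have "card \<dots> = (\<Sum>e\<in>S. card (P e))"
  proof (rule card_UN_disjoint)
    show "\<forall>e\<in>S. finite (P e)"
      using finite_perfect_matchings[OF Suc.prems(1)] by (auto simp: P_def)
    have "e = e'" if "e \<in> S" "e' \<in> S" "M \<in> P e" "M \<in> P e'" for e e' M
    proof -
      have "disjoint M" "e \<in> M" "e' \<in> M" "v \<in> e" "v \<in> e'"
        using that by (simp_all add: S_def P_def perfect_matchings_def)
      then show ?thesis unfolding disjoint_def by blast
    qed
    then show "\<forall>e\<in>S. \<forall>e'\<in>S. e \<noteq> e' \<longrightarrow> P e \<inter> P e' = {}"
      by blast
  qed fact
  also have "\<dots> = (\<Sum>e\<in>S. num_matchings r n)"
  proof (rule sum.cong[OF refl])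
    fix e assume "e \<in> S"
    then have e: "e \<subseteq> V" "card e = r" by (auto simp: S_def)
    have "card (P e) = card (perfect_matchings r (V - e))"
      unfolding P_def using card_perfect_matchings_containing[of r "{e}" V] e assms(1)
      by (simp add: disjoint_def)
    also have "card (V - e) = r * n"
      using e Suc.prems card_Diff_subset[of e V] finite_subset[of e V] by simp
    then have "card (perfect_matchings r (V - e)) = num_matchings r n"
      using Suc.IH[of "V - e"] Suc.prems(1) by simp
    finally show "card (P e) = num_matchings r n" .
  qed
  also have "\<dots> = num_matchings r (Suc n)"
    using card_subsets_containing[OF _ v assms(1)] Suc.prems
    by (simp add: num_matchings_Suc S_def)
  finally show ?case .
qed

lemma card_ordered_matchings: "r > 0 \<Longrightarrow> card (ordered_matchings r n) = num_matchings r n"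
  using card_perfect_matchings[of r "{1..r * n}" n]
  by (simp add: ordered_matchings_eq_perfect_matchings)

text \<open>The edges of \<open>F\<close> cover \<open>r * card F\<close> vertices, so the count
  depends on \<open>F\<close> only through its size. Divided by \<open>num_matchings r n\<close>, it
  is the probability that \<open>F\<close> lies in a random matching.\<close>

lemma card_ordered_matchings_containing:
  assumes "r > 0" "\<And>e. e \<in> F \<Longrightarrow> card e = r" "disjoint F" "\<Union>F \<subseteq> {1..r * n}"
  shows "card {M \<in> ordered_matchings r n. F \<subseteq> M} = num_matchings r (n - card F)"
proof -
  have fin: "finite e" if "e \<in> F" for e
    using assms(1,2) that by (metis card.infinite less_irrefl)
  have "card (\<Union>F) = (\<Sum>e\<in>F. card e)"
    using assms(3) fin by (intro card_Union_disjoint) (auto simp: disjoint_def pairwise_def disjnt_def)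
  then have "card (\<Union>F) = r * card F"
    using assms(2) by simp
  then have "card ({1..r * n} - \<Union>F) = r * (n - card F)"
    using assms(4) by (simp add: card_Diff_subset finite_subset diff_mult_distrib2)
  then have "card (perfect_matchings r ({1..r * n} - \<Union>F)) = num_matchings r (n - card F)"
    using assms(1) by (intro card_perfect_matchings) auto
  then show ?thesis
    using card_perfect_matchings_containing[of r F "{1..r * n}"] assms
    by (simp add: ordered_matchings_eq_perfect_matchings)
qed

text \<open>Passing from \<open>n - k\<close> to \<open>n\<close> adds \<open>k\<close> factors,
  each at most the last one.\<close>

lemma num_matchings_le:
  assumes "k \<le> n"
  shows "num_matchings r n \<le> num_matchings r (n - k) * ((r * n - 1) choose (r - 1)) ^ k"
  using assms
proof (induction k)
  case (Suc k)
  have "num_matchings r (n - k)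
      = num_matchings r (n - Suc k) * ((r * (n - k) - 1) choose (r - 1))"
    using num_matchings_Suc[of r "n - Suc k"] Suc.prems by (simp add: Suc_diff_Suc)
  also have "\<dots> \<le> num_matchings r (n - Suc k) * ((r * n - 1) choose (r - 1))"
    by (intro mult_left_mono binomial_right_mono diff_le_mono) auto
  finally have "num_matchings r (n - k) \<le> \<dots>" .
  then have "num_matchings r (n - k) * ((r * n - 1) choose (r - 1)) ^ k
      \<le> num_matchings r (n - Suc k) * ((r * n - 1) choose (r - 1)) ^ Suc k"
    by (metis mult.assoc mult_right_mono power_Suc zero_le)
  then show ?case using Suc by (meson Suc_leD le_trans)
qed simp

text \<open>The \<open>k\<close> topmost factors have index at least \<open>n - j\<close>, so each
  is at least the factor at \<open>n - j\<close>. Fixing \<open>j\<close> provides one common base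
  for families of different small sizes.\<close>

lemma num_matchings_ge:
  assumes "k \<le> Suc j" "j < n"
  shows "num_matchings r (n - k) * ((r * (n - j) - 1) choose (r - 1)) ^ k \<le> num_matchings r n"
  using assms
proof (induction k)
  case (Suc k)
  have "num_matchings r (n - Suc k) * ((r * (n - j) - 1) choose (r - 1))
      \<le> num_matchings r (n - Suc k) * ((r * (n - k) - 1) choose (r - 1))"
    using Suc.prems by (intro mult_left_mono binomial_right_mono diff_le_mono) auto
  also have "\<dots> = num_matchings r (n - k)"
    using num_matchings_Suc[of r "n - Suc k"] Suc.prems by (simp add: Suc_diff_Suc)
  finally have "num_matchings r (n - Suc k) * ((r * (n - j) - 1) choose (r - 1)) \<le> \<dots>" .
  then have "num_matchings r (n - Suc k) * ((r * (n - j) - 1) choose (r - 1)) ^ Suc k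
      \<le> num_matchings r (n - k) * ((r * (n - j) - 1) choose (r - 1)) ^ k"
    by (metis mult.assoc mult_right_mono power_Suc zero_le)
  then show ?case using Suc by (meson Suc_leD le_trans)
qed simp

lemma card_ordered_matchings_containing_ge:
  assumes "r > 0" "\<And>e. e \<in> F \<Longrightarrow> card e = r" "disjoint F" "\<Union>F \<subseteq> {1..r * n}" "card F \<le> n"
  shows "real (card (ordered_matchings r n)) * (1 / real ((r * n - 1) choose (r - 1))) ^ card F
      \<le> real (card {M \<in> ordered_matchings r n. F \<subseteq> M})"
\<comment> \<open>For \<open>n = 0\<close> the binomial coefficient may vanish and cannot be divided
  by; but then \<open>F\<close> is empty and both sides agree.\<close>
proof (cases "n = 0")
  case True
  then have "finite F" using assms(4) finite_UnionD[of F] by (metis finite_subset finite_atLeastAtMost)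
  with True assms(5) have "F = {}" by simp
  then show ?thesis by simp
next
  case False
  have "r - 1 \<le> r * n - 1"
    using False by (intro diff_le_mono) simp
  then have "real ((r * n - 1) choose (r - 1)) > 0" by simp
  moreover have "real (num_matchings r n)
      \<le> real (num_matchings r (n - card F)) * real ((r * n - 1) choose (r - 1)) ^ card F"
    using num_matchings_le[OF assms(5), of r] by (metis of_nat_le_iff of_nat_mult of_nat_power)
  ultimately show ?thesis
    using card_ordered_matchings_containing[OF assms(1-4)] card_ordered_matchings[OF assms(1)]
    by (simp add: field_simps)
qed

text \<open>A family lying in no matching has count zero; any other family inherits edge size and
  disjointness from a matching around it. The bound therefore applies to unions of two families
  whose edges may intersect.\<close>

lemma card_ordered_matchings_containing_le:
  assumes "r > 0" "card F \<le> Suc j" "j < n"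
  shows "real (card {M \<in> ordered_matchings r n. F \<subseteq> M})
      \<le> real (card (ordered_matchings r n)) * (1 / real ((r * (n - j) - 1) choose (r - 1))) ^ card F"
proof (cases "{M \<in> ordered_matchings r n. F \<subseteq> M} = {}")
  case True
  show ?thesis unfolding True by simp
next
  case False
  then obtain M where "M \<in> ordered_matchings r n" "F \<subseteq> M" by blast
  then have M: "\<forall>e\<in>M. card e = r" "disjoint M" "\<Union>M = {1..r * n}" "F \<subseteq> M"
    unfolding ordered_matchings_def mem_Collect_eq by iprover+
  have F: "\<And>e. e \<in> F \<Longrightarrow> card e = r" "disjoint F" "\<Union>F \<subseteq> {1..r * n}"
  proof -
    show "card e = r" if "e \<in> F" for e using M(1,4) that by blast
    show "disjoint F" using M(2,4) by (rule pairwise_subset)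
    show "\<Union>F \<subseteq> {1..r * n}" using Union_mono[OF M(4)] by (simp only: M(3))
  qed
  have "r - 1 \<le> r * (n - j) - 1"
    using assms by (intro diff_le_mono) simp
  then have "real ((r * (n - j) - 1) choose (r - 1)) > 0" by simp
  moreover have "real (num_matchings r (n - card F)) * real ((r * (n - j) - 1) choose (r - 1)) ^ card F
      \<le> real (num_matchings r n)"
    using num_matchings_ge[OF assms(2,3), of r] by (metis of_nat_le_iff of_nat_mult of_nat_power)
  ultimately show ?thesis
    using card_ordered_matchings_containing[OF assms(1) F] card_ordered_matchings[OF assms(1)]
    by (simp add: field_simps)
qed

subsection \<open>Second moments\<close>

text \<open>Expanding the square, the second moment calls for upper bounds on joint containment,
  while the cross term has the nonpositive coefficient \<open>- 2 * b\<close> and calls for lower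
  bounds on single containment.\<close>

lemma sum_square_deviation_le:
  fixes \<Omega> \<F> :: "'a set set" and \<alpha> \<sigma> b :: real
  assumes fin: "finite \<Omega>" "finite \<F>" and "b \<ge> 0"
    and lower: "\<And>F. F \<in> \<F> \<Longrightarrow> real (card \<Omega>) * \<alpha> \<le> real (card {M \<in> \<Omega>. F \<subseteq> M})"
    and upper: "\<And>F G. F \<in> \<F> \<Longrightarrow> G \<in> \<F> \<Longrightarrow>
      real (card {M \<in> \<Omega>. F \<union> G \<subseteq> M}) \<le> real (card \<Omega>) * \<sigma> ^ card (F \<union> G)"
  shows "(\<Sum>M\<in>\<Omega>. (real (card {F \<in> \<F>. F \<subseteq> M}) - b)\<^sup>2)
    \<le> real (card \<Omega>) * ((\<Sum>F\<in>\<F>. \<Sum>G\<in>\<F>. \<sigma> ^ card (F \<union> G)) - 2 * b * (real (card \<F>) * \<alpha>) + b\<^sup>2)"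
proof -
  define W where "W M = (\<Sum>F\<in>\<F>. of_bool (F \<subseteq> M) :: real)" for M
  have W: "real (card {F \<in> \<F>. F \<subseteq> M}) = W M" for M
    using fin by (simp add: W_def sum.If_cases of_bool_def Int_def)
  have count: "real (card {M \<in> \<Omega>. F \<subseteq> M}) = (\<Sum>M\<in>\<Omega>. of_bool (F \<subseteq> M))" for F
    using fin by (simp add: sum.If_cases of_bool_def Int_def)
  have "(\<Sum>M\<in>\<Omega>. W M * W M) = (\<Sum>F\<in>\<F>. \<Sum>G\<in>\<F>. real (card {M \<in> \<Omega>. F \<union> G \<subseteq> M}))"
  proof -
    have "(\<Sum>M\<in>\<Omega>. W M * W M) = (\<Sum>M\<in>\<Omega>. \<Sum>F\<in>\<F>. \<Sum>G\<in>\<F>. of_bool (F \<union> G \<subseteq> M))"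
      by (simp add: W_def sum_product flip: of_bool_conj)
    also have "\<dots> = (\<Sum>F\<in>\<F>. \<Sum>M\<in>\<Omega>. \<Sum>G\<in>\<F>. of_bool (F \<union> G \<subseteq> M))"
      by (rule sum.swap)
    also have "\<dots> = (\<Sum>F\<in>\<F>. \<Sum>G\<in>\<F>. \<Sum>M\<in>\<Omega>. of_bool (F \<union> G \<subseteq> M))"
      by (intro sum.cong refl sum.swap)
    finally show ?thesis by (simp only: count)
  qed
  also have "\<dots> \<le> (\<Sum>F\<in>\<F>. \<Sum>G\<in>\<F>. real (card \<Omega>) * \<sigma> ^ card (F \<union> G))"
    by (intro sum_mono upper)
  finally have sq: "(\<Sum>M\<in>\<Omega>. W M * W M) \<le> real (card \<Omega>) * (\<Sum>F\<in>\<F>. \<Sum>G\<in>\<F>. \<sigma> ^ card (F \<union> G))"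
    by (simp add: sum_distrib_left)
  have "(\<Sum>F\<in>\<F>. real (card \<Omega>) * \<alpha>) \<le> (\<Sum>F\<in>\<F>. \<Sum>M\<in>\<Omega>. of_bool (F \<subseteq> M))"
    using lower by (intro sum_mono) (simp only: count)
  also have "\<dots> = (\<Sum>M\<in>\<Omega>. W M)"
    unfolding W_def by (rule sum.swap)
  finally have "2 * b * (real (card \<F>) * (real (card \<Omega>) * \<alpha>)) \<le> 2 * b * (\<Sum>M\<in>\<Omega>. W M)"
    using \<open>b \<ge> 0\<close> by (intro mult_left_mono) auto
  moreover have "(\<Sum>M\<in>\<Omega>. (W M - b)\<^sup>2)
      = (\<Sum>M\<in>\<Omega>. W M * W M) - 2 * b * (\<Sum>M\<in>\<Omega>. W M) + real (card \<Omega>) * b\<^sup>2"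
  proof -
    have "(\<Sum>M\<in>\<Omega>. (W M - b)\<^sup>2) = (\<Sum>M\<in>\<Omega>. W M * W M - 2 * b * W M + b\<^sup>2)"
      by (intro sum.cong refl) (simp add: power2_eq_square algebra_simps)
    then show ?thesis by (simp add: sum.distrib sum_subtractf sum_distrib_left)
  qed
  ultimately show ?thesis
    using sq unfolding W by (simp add: algebra_simps)
qed

text \<open>The deviation is measured from \<open>card \<F> * \<rho> ^ k\<close> instead of the mean, so that one-sided
  bounds on the containment probabilities suffice.\<close>

lemma card_large_deviations_le:
  fixes \<Omega> \<F> :: "'a set set" and \<rho> \<sigma> d :: real
  assumes fin: "finite \<Omega>" "finite \<F>" and "\<rho> \<ge> 0" "\<sigma> \<ge> 0" "d \<ge> 0"
    and card: "\<And>F. F \<in> \<F> \<Longrightarrow> finite F \<and> card F = k"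
    and lower: "\<And>F. F \<in> \<F> \<Longrightarrow> real (card \<Omega>) * \<rho> ^ k \<le> real (card {M \<in> \<Omega>. F \<subseteq> M})"
    and upper: "\<And>F G. F \<in> \<F> \<Longrightarrow> G \<in> \<F> \<Longrightarrow>
      real (card {M \<in> \<Omega>. F \<union> G \<subseteq> M}) \<le> real (card \<Omega>) * \<sigma> ^ card (F \<union> G)"
  shows "real (card {M \<in> \<Omega>. d \<le> \<bar>real (card {F \<in> \<F>. F \<subseteq> M}) - real (card \<F>) * \<rho> ^ k\<bar>}) * d\<^sup>2
    \<le> real (card \<Omega>) * ((real (card \<F>))\<^sup>2 * (\<sigma> ^ (2 * k) - \<rho> ^ (2 * k))
        + (\<Sum>(F, G)\<in>{(F, G) \<in> \<F> \<times> \<F>. F \<inter> G \<noteq> {}}. \<sigma> ^ card (F \<union> G)))"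
proof -
  define b where "b = real (card \<F>) * \<rho> ^ k"
  define R where "R = {(F, G) \<in> \<F> \<times> \<F>. F \<inter> G \<noteq> {}}"
  define W where "W M = real (card {F \<in> \<F>. F \<subseteq> M})" for M
  have "finite R" unfolding R_def using fin by (auto intro: finite_subset[of _ "\<F> \<times> \<F>"])
  have "R \<subseteq> \<F> \<times> \<F>" by (auto simp: R_def)
  have "(\<Sum>F\<in>\<F>. \<Sum>G\<in>\<F>. \<sigma> ^ card (F \<union> G)) = (\<Sum>(F, G)\<in>\<F> \<times> \<F>. \<sigma> ^ card (F \<union> G))"
    by (simp add: sum.cartesian_product)
  also have "\<dots> = (\<Sum>(F, G)\<in>\<F> \<times> \<F> - R. \<sigma> ^ card (F \<union> G)) + (\<Sum>(F, G)\<in>R. \<sigma> ^ card (F \<union> G))"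
    using fin \<open>R \<subseteq> \<F> \<times> \<F>\<close> by (intro sum.subset_diff) auto
  \<comment> \<open>Outside \<open>R\<close> the two families share no edge, so their union has
    exactly \<open>2 * k\<close> edges.\<close>
  also have "(\<Sum>(F, G)\<in>\<F> \<times> \<F> - R. \<sigma> ^ card (F \<union> G)) = (\<Sum>p\<in>\<F> \<times> \<F> - R. \<sigma> ^ (2 * k))"
    using card by (intro sum.cong refl) (auto simp: R_def card_Un_disjoint mult_2)
  \<comment> \<open>Summing over all pairs again makes the main term comparable with
    \<open>b\<^sup>2\<close>; their difference yields
    \<open>\<sigma> ^ (2 * k) - \<rho> ^ (2 * k)\<close>.\<close>
  also have "\<dots> \<le> (\<Sum>p\<in>\<F> \<times> \<F>. \<sigma> ^ (2 * k))"
    using fin \<open>\<sigma> \<ge> 0\<close> by (intro sum_mono2) auto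
  finally have pairs: "(\<Sum>F\<in>\<F>. \<Sum>G\<in>\<F>. \<sigma> ^ card (F \<union> G))
      \<le> (real (card \<F>))\<^sup>2 * \<sigma> ^ (2 * k) + (\<Sum>(F, G)\<in>R. \<sigma> ^ card (F \<union> G))"
    by (simp add: card_cartesian_product power2_eq_square)
  \<comment> \<open>Chebyshev's inequality in counting form: every counted \<open>M\<close>
    contributes at least \<open>d\<^sup>2\<close> to the sum of squared deviations.\<close>
  have "real (card {M \<in> \<Omega>. d \<le> \<bar>W M - b\<bar>}) * d\<^sup>2 = (\<Sum>M\<in>{M \<in> \<Omega>. d \<le> \<bar>W M - b\<bar>}. d\<^sup>2)"
    by simp
  also have "\<dots> \<le> (\<Sum>M\<in>{M \<in> \<Omega>. d \<le> \<bar>W M - b\<bar>}. (W M - b)\<^sup>2)"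
    using \<open>d \<ge> 0\<close> by (intro sum_mono) (auto simp: abs_le_square_iff[symmetric])
  also have "\<dots> \<le> (\<Sum>M\<in>\<Omega>. (W M - b)\<^sup>2)"
    using fin by (intro sum_mono2) auto
  also have "\<dots> \<le> real (card \<Omega>) * ((\<Sum>F\<in>\<F>. \<Sum>G\<in>\<F>. \<sigma> ^ card (F \<union> G)) - 2 * b * b + b\<^sup>2)"
    using sum_square_deviation_le[OF fin, of b "\<rho> ^ k" \<sigma>] lower upper \<open>\<rho> \<ge> 0\<close>
    unfolding W_def b_def by simp
  also have "\<dots> \<le> real (card \<Omega>) * ((real (card \<F>))\<^sup>2 * (\<sigma> ^ (2 * k) - \<rho> ^ (2 * k))
        + (\<Sum>(F, G)\<in>R. \<sigma> ^ card (F \<union> G)))"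
  proof (rule mult_left_mono)
    have "b\<^sup>2 = (real (card \<F>))\<^sup>2 * \<rho> ^ (2 * k)"
      by (simp add: b_def power_mult_distrib power_mult mult.commute flip: power_mult)
    then show "(\<Sum>F\<in>\<F>. \<Sum>G\<in>\<F>. \<sigma> ^ card (F \<union> G)) - 2 * b * b + b\<^sup>2
      \<le> (real (card \<F>))\<^sup>2 * (\<sigma> ^ (2 * k) - \<rho> ^ (2 * k)) + (\<Sum>(F, G)\<in>R. \<sigma> ^ card (F \<union> G))"
      using pairs by (simp add: power2_eq_square algebra_simps)
  qed simp
  finally show ?thesis
    unfolding W_def b_def R_def .
qed

section \<open>Pairs of edges inside a common block, and their overlaps\<close>

lemma card_pairs_in_blocks_le:
  assumes "\<And>i. i < m \<Longrightarrow> finite (E i) \<and> card (E i) = T"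
    and "\<F> \<subseteq> {F. (\<exists>i<m. F \<subseteq> E i) \<and> card F = 2}"
  shows "finite \<F>" and "real (card \<F>) \<le> real m * (real T)\<^sup>2 / 2"
proof -
  define S where "S i = {F. F \<subseteq> E i \<and> card F = 2}" for i
  have "card (S i) = T choose 2" "finite (S i)" if "i < m" for i
    using assms(1)[OF that] n_subsets[of "E i" 2] unfolding S_def
    by (auto intro: finite_subset[of _ "Pow (E i)"])
  note S = this
  have sub: "\<F> \<subseteq> (\<Union>i<m. S i)" using assms(2) by (auto simp: S_def)
  have finU: "finite (\<Union>i<m. S i)" using S by auto
  show "finite \<F>" by (rule finite_subset[OF sub finU])
  have "card \<F> \<le> card (\<Union>i<m. S i)" by (rule card_mono[OF finU sub])
  also have "\<dots> \<le> (\<Sum>i<m. card (S i))" by (rule card_UN_le) simp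
  also have "\<dots> = m * (T choose 2)" using S by simp
  finally have "real (card \<F>) \<le> real (m * (T choose 2))" by (rule of_nat_mono)
  also have "real (T choose 2) \<le> (real T)\<^sup>2 / 2"
    using binomial_fact_pow[of T 2] by (simp add: field_simps flip: of_nat_power)
  then have "real (m * (T choose 2)) \<le> real m * (real T)\<^sup>2 / 2"
    using mult_left_mono[of "real (T choose 2)" "(real T)\<^sup>2 / 2" "real m"] by simp
  finally show "real (card \<F>) \<le> real m * (real T)\<^sup>2 / 2" .
qed

text \<open>Overlapping pairs either coincide, with a union of two edges, or share exactly one edge,
  with a union of three edges that all lie in one block. The two summands bound these cases.\<close>

lemma sum_overlapping_pairs_le:
  fixes \<sigma> :: real
  assumes E: "\<And>i. i < m \<Longrightarrow> finite (E i) \<and> card (E i) = T"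
    and disj: "\<And>i j. i < m \<Longrightarrow> j < m \<Longrightarrow> i \<noteq> j \<Longrightarrow> E i \<inter> E j = {}"
    and \<F>: "\<F> \<subseteq> {F. (\<exists>i<m. F \<subseteq> E i) \<and> card F = 2}"
    and "\<sigma> \<ge> 0"
  shows "(\<Sum>(F, G)\<in>{(F, G) \<in> \<F> \<times> \<F>. F \<inter> G \<noteq> {}}. \<sigma> ^ card (F \<union> G))
    \<le> real m * (real T)\<^sup>2 / 2 * \<sigma>\<^sup>2 + real m * real T ^ 3 * \<sigma> ^ 3"
proof -
  define D where "D = (\<lambda>F. (F, F)) ` \<F>"
  define R where "R = {(F, G) \<in> \<F> \<times> \<F>. F \<inter> G \<noteq> {} \<and> F \<noteq> G}"
  \<comment> \<open>A tuple records the block, the shared edge and the two remaining edges; its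
    image covers all overlaps of the second kind, possibly with repetitions.\<close>
  define Q where "Q = (SIGMA i:{..<m}. E i \<times> E i \<times> E i)"
  have fin\<F>: "finite \<F>" by (rule card_pairs_in_blocks_le[OF E \<F>])
  have finQ: "finite Q" unfolding Q_def using E by auto
  have finO: "finite R" unfolding R_def using fin\<F> by (auto intro: finite_subset[of _ "\<F> \<times> \<F>"])
  have cardQ: "card Q = m * T ^ 3"
    unfolding Q_def using E by (simp add: card_cartesian_product power3_eq_cube mult.assoc)
  have R: "(F, G) \<in> (\<lambda>(i, e, f, g). ({e, f}, {e, g})) ` Q \<and> card (F \<union> G) = 3"
    if FG: "(F, G) \<in> R" for F G
  proof -
    from FG have "F \<in> \<F>" "G \<in> \<F>" "F \<inter> G \<noteq> {}" "F \<noteq> G" by (auto simp: R_def)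
    then obtain i j e where ij: "i < m" "j < m" "F \<subseteq> E i" "G \<subseteq> E j" "card F = 2" "card G = 2"
      and e: "e \<in> F" "e \<in> G" using \<F> by blast
    obtain f where f: "F = {e, f}" "f \<noteq> e"
      using ij(5) e(1) by (auto simp: card_2_iff)
    obtain g where g: "G = {e, g}" "g \<noteq> e"
      using ij(6) e(2) by (auto simp: card_2_iff)
    \<comment> \<open>The shared edge belongs to one block only.\<close>
    have "i = j" using disj[OF ij(1,2)] ij e by blast
    then have "(i, e, f, g) \<in> Q" using ij f g by (auto simp: Q_def)
    then have "(F, G) \<in> (\<lambda>(i, e, f, g). ({e, f}, {e, g})) ` Q"
      using f(1) g(1) by (auto intro!: image_eqI[of _ _ "(i, e, f, g)"])
    moreover have "F \<union> G = {e, f, g}" "f \<noteq> g" using f g \<open>F \<noteq> G\<close> by auto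
    ultimately show ?thesis using f(2) g(2) by auto
  qed
  have "card R \<le> card ((\<lambda>(i, e, f, g). ({e, f}, {e, g})) ` Q)"
    using R by (intro card_mono) (auto simp: finQ)
  also have "\<dots> \<le> m * T ^ 3"
    using card_image_le[OF finQ] cardQ by metis
  finally have "real (card R) \<le> real (m * T ^ 3)" by (rule of_nat_mono)
  then have "real (card R) * \<sigma> ^ 3 \<le> real m * real T ^ 3 * \<sigma> ^ 3"
    using \<open>\<sigma> \<ge> 0\<close> by (intro mult_right_mono) auto
  moreover have "(\<Sum>(F, G)\<in>R. \<sigma> ^ card (F \<union> G)) = (\<Sum>p\<in>R. \<sigma> ^ 3)"
    using R by (intro sum.cong refl) auto
  ultimately have sumO: "(\<Sum>(F, G)\<in>R. \<sigma> ^ card (F \<union> G)) \<le> real m * real T ^ 3 * \<sigma> ^ 3"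
    by simp
  have "(\<Sum>(F, G)\<in>D. \<sigma> ^ card (F \<union> G)) = (\<Sum>F\<in>\<F>. \<sigma> ^ card F)"
    unfolding D_def by (subst sum.reindex) (auto simp: inj_on_def)
  also have "\<dots> = (\<Sum>F\<in>\<F>. \<sigma>\<^sup>2)"
    using \<F> by (intro sum.cong refl) auto
  also have "\<dots> \<le> real m * (real T)\<^sup>2 / 2 * \<sigma>\<^sup>2"
    using mult_right_mono[OF card_pairs_in_blocks_le(2)[OF E \<F>], of "\<sigma>\<^sup>2"] by simp
  finally have sumD: "(\<Sum>(F, G)\<in>D. \<sigma> ^ card (F \<union> G)) \<le> real m * (real T)\<^sup>2 / 2 * \<sigma>\<^sup>2" .
  have "F \<noteq> {}" if "F \<in> \<F>" for F using that \<F> by auto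
  then have "{(F, G) \<in> \<F> \<times> \<F>. F \<inter> G \<noteq> {}} = D \<union> R"
    by (auto simp: D_def R_def)
  moreover have "finite D" "D \<inter> R = {}" using fin\<F> by (auto simp: D_def R_def)
  ultimately show ?thesis
    using sumD sumO finO by (simp add: sum.union_disjoint)
qed

subsection \<open>Lines from edges inside blocks\<close>

text \<open>Choosing one edge per nonempty block gives a line; every other edge inside a block is
  charged to the pair it forms with the chosen edge of its block.\<close>

lemma line_from_blocks:
  fixes M :: "nat set set"
  assumes "finite M" "disjoint M"
    and E: "\<And>i e. i < m \<Longrightarrow> e \<in> E i \<Longrightarrow> e \<noteq> {} \<and> e \<subseteq> {t * i + 1..t * i + t}"
  shows "\<exists>L. is_line M L \<and> card (M \<inter> (\<Union>i<m. E i))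
    \<le> card L + card {F. (\<exists>i<m. F \<subseteq> E i) \<and> card F = 2 \<and> disjoint F \<and> F \<subseteq> M}"
proof -
  have less: "x < y" if "i < m" "j < m" "i < j" "e \<in> E i" "f \<in> E j" "x \<in> e" "y \<in> f" for i j e f x y
  proof -
    have "x \<le> t * i + t" "t * j + 1 \<le> y" using E that by fastforce+
    moreover have "t * i + t \<le> t * j" using mult_le_mono2[of "Suc i" j t] that by simp
    ultimately show ?thesis by linarith
  qed
  have uniq: "i = j" if ij: "i < m" "j < m" "e \<in> E i" "e \<in> E j" for i j e
  proof -
    obtain x where "x \<in> e" using E[OF ij(1,3)] by blast
    then show ?thesis using less[of i j e e x x] less[of j i e e x x] ij by (metis less_irrefl linorder_neqE_nat)
  qed
  define I where "I = {i. i < m \<and> M \<inter> E i \<noteq> {}}"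
  define rep where "rep i = (SOME e. e \<in> M \<inter> E i)" for i
  define L where "L = rep ` I"
  define idx where "idx e = (SOME i. i < m \<and> e \<in> E i)" for e
  define P where "P = {F. (\<exists>i<m. F \<subseteq> E i) \<and> card F = 2 \<and> disjoint F \<and> F \<subseteq> M}"
  define A where "A = M \<inter> (\<Union>i<m. E i)"
  have rep: "rep i \<in> M" "rep i \<in> E i" "i < m" if "i \<in> I" for i
    using that someI_ex[of "\<lambda>e. e \<in> M \<inter> E i"] unfolding I_def rep_def by auto
  have idx: "idx e < m" "e \<in> E (idx e)" "idx e \<in> I" if "e \<in> A" for e
  proof -
    have "\<exists>i. i < m \<and> e \<in> E i" using that by (auto simp: A_def)
    from someI_ex[OF this] show "idx e < m" "e \<in> E (idx e)" unfolding idx_def by auto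
    then show "idx e \<in> I" using that by (auto simp: I_def A_def)
  qed
  have "finite I" by (simp add: I_def)
  have "inj_on rep I"
    using rep uniq by (intro inj_onI) metis
  have "is_line M L"
    unfolding is_line_def
  \<comment> \<open>Listing the chosen edges by increasing block index puts them in the order of a
    line.\<close>
  proof (intro conjI exI[of _ "map rep (sorted_list_of_set I)"] allI impI ballI)
    show "L \<subseteq> M" using rep by (auto simp: L_def)
    show "distinct (map rep (sorted_list_of_set I))"
      using \<open>finite I\<close> \<open>inj_on rep I\<close> by (simp add: distinct_map)
    show "set (map rep (sorted_list_of_set I)) = L"
      using \<open>finite I\<close> by (simp add: L_def)
    fix k x y
    assume k: "Suc k < length (map rep (sorted_list_of_set I))"
      and x: "x \<in> map rep (sorted_list_of_set I) ! k"
      and y: "y \<in> map rep (sorted_list_of_set I) ! Suc k"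
    let ?i = "sorted_list_of_set I ! k" and ?j = "sorted_list_of_set I ! Suc k"
    have "?i < ?j"
      using k strict_sorted_list_of_set[of I]
      by (simp add: sorted_wrt_iff_nth_less)
    moreover have "?i \<in> I" "?j \<in> I"
      using k \<open>finite I\<close> nth_mem[of k "sorted_list_of_set I"] nth_mem[of "Suc k" "sorted_list_of_set I"]
      by auto
    ultimately show "x < y"
      using less[of ?i ?j "rep ?i" "rep ?j" x y] rep x y k by simp
  qed
  moreover have "card A \<le> card L + card P"
  proof -
    \<comment> \<open>The charging map. It is injective off \<open>L\<close> because
      \<open>e\<close> is recovered as the only member of \<open>\<phi> e\<close> outside
      \<open>L\<close>.\<close>
    define \<phi> where "\<phi> e = {e, rep (idx e)}" for e
    have "finite P"
      by (rule finite_subset[of _ "Pow M"]) (use assms(1) in \<open>auto simp: P_def\<close>)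
    have "finite L" using \<open>finite I\<close> by (simp add: L_def)
    have repL: "rep (idx e) \<in> L" if "e \<in> A" for e
      using idx[OF that] by (auto simp: L_def)
    have "\<phi> e \<in> P" if "e \<in> A - L" for e
    proof -
      have e: "e \<in> A" "e \<notin> L" using that by auto
      have "\<phi> e \<subseteq> E (idx e)" using idx[OF e(1)] rep[of "idx e"] by (simp add: \<phi>_def)
      moreover have "card (\<phi> e) = 2" using repL[OF e(1)] e(2) by (auto simp: \<phi>_def card_insert_if)
      moreover have "\<phi> e \<subseteq> M" using idx[OF e(1)] rep[of "idx e"] e(1) by (simp add: \<phi>_def A_def)
      moreover have "disjoint (\<phi> e)" by (rule pairwise_subset[OF assms(2)]) fact
      ultimately show ?thesis using idx(1)[OF e(1)] by (auto simp: P_def)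
    qed
    moreover have "inj_on \<phi> (A - L)"
    proof (rule inj_onI)
      fix e f assume "e \<in> A - L" "f \<in> A - L" "\<phi> e = \<phi> f"
      then show "e = f" using repL[of e] repL[of f] by (auto simp: \<phi>_def doubleton_eq_iff)
    qed
    ultimately have "card (A - L) \<le> card P"
      using \<open>finite P\<close> by (intro card_inj_on_le[of \<phi>]) auto
    moreover have "card A \<le> card L + card (A - L)"
      using card_mono[of "L \<union> (A - L)" A] card_Un_le[of L "A - L"] \<open>finite L\<close> assms(1)
      by (fastforce simp: A_def)
    ultimately show ?thesis by linarith
  qed
  ultimately show ?thesis unfolding A_def P_def by blast
qed

section \<open>Bounding the number of matchings without a long line\<close>

lemma pred_le_mult_pred: "n > 0 \<Longrightarrow> r - 1 \<le> r * n - 1" for r n :: nat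
  by (intro diff_le_mono) simp

text \<open>The bases \<open>\<rho>\<close> and \<open>\<sigma>\<close> bound containment
  probabilities from below and above, and \<open>\<kappa>\<close> measures the loss between them.
  Chebyshev's inequality with deviations \<open>m \<mu> / 2\<close> and \<open>m \<mu> / 8\<close>
  produces the factors 4 and 64. The remaining terms are small once \<open>\<kappa>\<close> is near
  1 and both \<open>m\<close> and \<open>m \<mu>\<close> are large.\<close>

lemma card_matchings_without_line_le:
  fixes r n m t :: nat and \<rho> \<sigma> \<mu> :: real
  assumes "r > 0" "n \<ge> 4" "m * t \<le> r * n" "m > 0"
  defines "\<rho> \<equiv> 1 / real ((r * n - 1) choose (r - 1))"
    and "\<sigma> \<equiv> 1 / real ((r * (n - 3) - 1) choose (r - 1))"
  defines "\<mu> \<equiv> real (t choose r) * \<rho>" and "\<kappa> \<equiv> \<sigma> / \<rho>"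
  assumes "0 < \<mu>" "\<mu> \<le> 1 / 2"
  shows "real (card {M \<in> ordered_matchings r n. \<nexists>L. is_line M L \<and> real m * \<mu> / 8 \<le> real (card L)})
    \<le> real (card (ordered_matchings r n)) *
      (4 * ((\<kappa>\<^sup>2 - 1) + \<kappa> / (real m * \<mu>)) + 64 * ((\<kappa> ^ 4 - 1) + (\<kappa>\<^sup>2 + \<kappa> ^ 3) / real m))"
proof -
  define \<Omega> where "\<Omega> = ordered_matchings r n"
  define T where "T = t choose r"
  define E where "E i = {e. e \<subseteq> {t * i + 1..t * i + t} \<and> card e = r}" for i
  \<comment> \<open>Edges are wrapped as singletons so that the same deviation bound handles
    \<open>X\<close> with \<open>k = 1\<close> and \<open>Z\<close> with
    \<open>k = 2\<close>.\<close>
  define \<F>1 where "\<F>1 = (\<lambda>e. {e}) ` (\<Union>i<m. E i)"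
  \<comment> \<open>Two distinct intersecting edges never occur together in a matching, and the
    lower bound on containment fails for them, so such pairs are left out.\<close>
  define \<F>2 where "\<F>2 = {F. (\<exists>i<m. F \<subseteq> E i) \<and> card F = 2 \<and> disjoint F}"
  define X where "X M = card {F \<in> \<F>1. F \<subseteq> M}" for M
  define Z where "Z M = card {F \<in> \<F>2. F \<subseteq> M}" for M
  \<comment> \<open>The reference value is \<open>m \<mu>\<close> for \<open>X\<close> and at most
    \<open>m \<mu> / 4\<close> for \<open>Z\<close>. Outside both bad sets, \<open>X - Z\<close>
    thus exceeds \<open>m \<mu>\<close> times \<open>1/2 - 1/4 - 1/8 = 1/8\<close>.\<close>
  define bad1 where "bad1 = {M \<in> \<Omega>. real m * \<mu> / 2 \<le> \<bar>real (X M) - real (card \<F>1) * \<rho> ^ 1\<bar>}"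
  define bad2 where "bad2 = {M \<in> \<Omega>. real m * \<mu> / 8 \<le> \<bar>real (Z M) - real (card \<F>2) * \<rho> ^ 2\<bar>}"
  have fin\<Omega>: "finite \<Omega>" unfolding \<Omega>_def by (rule finite_ordered_matchings)
  have "r - 1 \<le> r * n - 1" "r - 1 \<le> r * (n - 3) - 1"
    using assms(2) by (intro pred_le_mult_pred; linarith)+
  then have \<rho>: "\<rho> > 0" and \<sigma>: "\<sigma> > 0" by (simp_all add: \<rho>_def \<sigma>_def)
  have \<sigma>eq: "\<sigma> = \<kappa> * \<rho>" using \<rho> by (simp add: \<kappa>_def)
  have \<mu>: "\<mu> = real T * \<rho>" by (simp add: \<mu>_def T_def)
  have "(r * (n - 3) - 1) choose (r - 1) \<le> (r * n - 1) choose (r - 1)"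
    by (intro binomial_right_mono diff_le_mono mult_le_mono2) auto
  moreover have "(r * (n - 3) - 1) choose (r - 1) > 0"
    using \<open>r - 1 \<le> r * (n - 3) - 1\<close> by (rule zero_less_binomial)
  ultimately have "\<rho> \<le> \<sigma>"
    unfolding \<rho>_def \<sigma>_def by (intro frac_le) auto
  then have \<kappa>: "\<kappa> \<ge> 1" using \<rho> by (simp add: \<kappa>_def)
  have E: "finite (E i) \<and> card (E i) = T" for i
    unfolding E_def T_def using n_subsets[of "{t * i + 1..t * i + t}" r]
    by (auto intro: finite_subset[of _ "Pow {t * i + 1..t * i + t}"])
  have E_edge: "e \<noteq> {} \<and> e \<subseteq> {t * i + 1..t * i + t}" if "e \<in> E i" for i e
    using that \<open>r > 0\<close> by (auto simp: E_def)
  have disjE: "E i \<inter> E j = {}" if "i \<noteq> j" for i j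
  proof -
    have *: "E i \<inter> E j = {}" if "i < j" for i j
    proof (rule ccontr)
      assume "E i \<inter> E j \<noteq> {}"
      then obtain e where "e \<in> E i" "e \<in> E j" by blast
      then obtain x where "x \<in> {t * i + 1..t * i + t}" "x \<in> {t * j + 1..t * j + t}"
        using E_edge[of e i] E_edge[of e j] by blast
      moreover have "t * i + t \<le> t * j" using mult_le_mono2[of "Suc i" j t] that by simp
      ultimately show False by simp
    qed
    show ?thesis using *[of i j] *[of j i] that by (cases "i < j") auto
  qed
  have E_sub: "e \<subseteq> {1..r * n}" "card e = r" if "i < m" "e \<in> E i" for i e
  proof -
    have "t * i + t \<le> t * m" using mult_le_mono2[of "Suc i" m t] that by simp
    then have "t * i + t \<le> r * n" using assms(3) by (simp add: mult.commute)
    then show "e \<subseteq> {1..r * n}" using E_edge[OF that(2)] by auto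
    show "card e = r" using that by (simp add: E_def)
  qed
  \<comment> \<open>Two pairs involve at most four edges; this is why \<open>\<sigma>\<close> comes
    from the factor at \<open>n - 3\<close>, the fourth from the top.\<close>
  have upper: "real (card {M \<in> \<Omega>. F \<subseteq> M}) \<le> real (card \<Omega>) * \<sigma> ^ card F" if "card F \<le> 4" for F
    unfolding \<Omega>_def \<sigma>_def using assms(1,2) that
    by (intro card_ordered_matchings_containing_le) auto
  have lower: "real (card \<Omega>) * \<rho> ^ card F \<le> real (card {M \<in> \<Omega>. F \<subseteq> M})"
    if "i < m" "F \<subseteq> E i" "disjoint F" "card F \<le> 4" for F i
    unfolding \<Omega>_def \<rho>_def using assms(1,2) that E_sub[OF that(1)]
    by (intro card_ordered_matchings_containing_ge) auto

  have "finite (\<Union>i<m. E i)" using E by auto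
  have "inj_on (\<lambda>e. {e}) (\<Union>i<m. E i)" by (auto simp: inj_on_def)
  then have "card \<F>1 = card (\<Union>i<m. E i)"
    unfolding \<F>1_def by (rule card_image)
  also have "\<dots> = (\<Sum>i<m. card (E i))"
    using E disjE by (intro card_UN_disjoint) auto
  finally have card\<F>1: "card \<F>1 = m * T" using E by simp
  have \<F>2: "\<F>2 \<subseteq> {F. (\<exists>i<m. F \<subseteq> E i) \<and> card F = 2}" by (auto simp: \<F>2_def)
  note card\<F>2 = card_pairs_in_blocks_le[OF E \<F>2]

  have bad1: "real (card bad1) \<le> real (card \<Omega>) * (4 * ((\<kappa>\<^sup>2 - 1) + \<kappa> / (real m * \<mu>)))"
  proof -
    have "real (card bad1) * (real m * \<mu> / 2)\<^sup>2
      \<le> real (card \<Omega>) * ((real (card \<F>1))\<^sup>2 * (\<sigma> ^ (2 * 1) - \<rho> ^ (2 * 1))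
        + (\<Sum>(F, G)\<in>{(F, G) \<in> \<F>1 \<times> \<F>1. F \<inter> G \<noteq> {}}. \<sigma> ^ card (F \<union> G)))"
      unfolding bad1_def X_def
    proof (rule card_large_deviations_le)
      show "finite \<F>1" unfolding \<F>1_def using \<open>finite (\<Union>i<m. E i)\<close> by simp
      show "real (card \<Omega>) * \<rho> ^ 1 \<le> real (card {M \<in> \<Omega>. F \<subseteq> M})" if "F \<in> \<F>1" for F
      proof -
        from that obtain i e where "i < m" "e \<in> E i" "F = {e}" by (auto simp: \<F>1_def)
        then show ?thesis using lower[of i F] by (simp add: disjoint_def)
      qed
      show "real (card {M \<in> \<Omega>. F \<union> G \<subseteq> M}) \<le> real (card \<Omega>) * \<sigma> ^ card (F \<union> G)"
        if "F \<in> \<F>1" "G \<in> \<F>1" for F G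
        using that card_Un_le[of F G] by (intro upper) (auto simp: \<F>1_def)
    qed (use \<rho> \<sigma> fin\<Omega> \<open>0 < \<mu>\<close> in \<open>auto simp: \<F>1_def\<close>)
    \<comment> \<open>Singletons meet only when equal, so the overlap sum runs over the
      diagonal.\<close>
    also have "{(F, G) \<in> \<F>1 \<times> \<F>1. F \<inter> G \<noteq> {}} = (\<lambda>F. (F, F)) ` \<F>1"
      by (auto simp: \<F>1_def)
    also have "(\<Sum>(F, G)\<in>(\<lambda>F. (F, F)) ` \<F>1. \<sigma> ^ card (F \<union> G)) = (\<Sum>F\<in>\<F>1. \<sigma>)"
    proof -
      have "(\<Sum>(F, G)\<in>(\<lambda>F. (F, F)) ` \<F>1. \<sigma> ^ card (F \<union> G)) = (\<Sum>F\<in>\<F>1. \<sigma> ^ card F)"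
        by (subst sum.reindex) (auto simp: inj_on_def)
      also have "\<dots> = (\<Sum>F\<in>\<F>1. \<sigma>)"
        by (intro sum.cong refl) (auto simp: \<F>1_def)
      finally show ?thesis .
    qed
    also have "(real (card \<F>1))\<^sup>2 * (\<sigma> ^ (2 * 1) - \<rho> ^ (2 * 1)) + (\<Sum>F\<in>\<F>1. \<sigma>)
        = 4 * ((\<kappa>\<^sup>2 - 1) + \<kappa> / (real m * \<mu>)) * (real m * \<mu> / 2)\<^sup>2"
      using \<open>0 < \<mu>\<close> \<open>m > 0\<close> unfolding sum_constant card\<F>1 \<sigma>eq \<mu>
      by (simp add: field_simps power2_eq_square)
    finally show ?thesis
      using \<open>0 < \<mu>\<close> \<open>m > 0\<close> by (simp flip: mult.assoc)
  qed

  have bad2: "real (card bad2) \<le> real (card \<Omega>) * (64 * ((\<kappa> ^ 4 - 1) + (\<kappa>\<^sup>2 + \<kappa> ^ 3) / real m))"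
  proof -
    have "real (card bad2) * (real m * \<mu> / 8)\<^sup>2
      \<le> real (card \<Omega>) * ((real (card \<F>2))\<^sup>2 * (\<sigma> ^ (2 * 2) - \<rho> ^ (2 * 2))
        + (\<Sum>(F, G)\<in>{(F, G) \<in> \<F>2 \<times> \<F>2. F \<inter> G \<noteq> {}}. \<sigma> ^ card (F \<union> G)))"
      unfolding bad2_def Z_def
    proof (rule card_large_deviations_le)
      show "finite F \<and> card F = 2" if "F \<in> \<F>2" for F
        using that by (auto simp: \<F>2_def intro: card_ge_0_finite)
      show "real (card \<Omega>) * \<rho> ^ 2 \<le> real (card {M \<in> \<Omega>. F \<subseteq> M})" if "F \<in> \<F>2" for F
        using that lower[of _ F] by (auto simp: \<F>2_def)
      show "real (card {M \<in> \<Omega>. F \<union> G \<subseteq> M}) \<le> real (card \<Omega>) * \<sigma> ^ card (F \<union> G)"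
        if "F \<in> \<F>2" "G \<in> \<F>2" for F G
        using that card_Un_le[of F G] by (intro upper) (auto simp: \<F>2_def)
    qed (use \<rho> \<sigma> fin\<Omega> \<open>0 < \<mu>\<close> card\<F>2 in auto)
    also have "\<dots> \<le> real (card \<Omega>) * (64 * ((\<kappa> ^ 4 - 1) + (\<kappa>\<^sup>2 + \<kappa> ^ 3) / real m) * (real m * \<mu> / 8)\<^sup>2)"
    proof (rule mult_left_mono)
      have "(\<Sum>(F, G)\<in>{(F, G) \<in> \<F>2 \<times> \<F>2. F \<inter> G \<noteq> {}}. \<sigma> ^ card (F \<union> G))
          \<le> real m * (real T)\<^sup>2 / 2 * \<sigma>\<^sup>2 + real m * real T ^ 3 * \<sigma> ^ 3"
        using \<sigma> disjE by (intro sum_overlapping_pairs_le[OF E _ \<F>2]) auto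
      also have "\<dots> = real m * (\<mu>\<^sup>2 * \<kappa>\<^sup>2) / 2 + real m * (\<mu> ^ 3 * \<kappa> ^ 3)"
        unfolding \<sigma>eq \<mu> by (simp add: power_mult_distrib)
      \<comment> \<open>Since \<open>\<mu> \<le> 1 / 2\<close>, the cube of \<open>\<mu>\<close> is
        at most its square. The common factor \<open>\<mu>\<^sup>2\<close> then cancels against the
        squared deviation, leaving a term of order \<open>1 / m\<close>.\<close>
      also have "\<dots> \<le> real m * (\<mu>\<^sup>2 * \<kappa>\<^sup>2) + real m * (\<mu>\<^sup>2 * \<kappa> ^ 3)"
        using \<open>0 < \<mu>\<close> \<open>\<mu> \<le> 1 / 2\<close> \<kappa>
        by (intro add_mono mult_left_mono mult_right_mono power_decreasing) auto
      finally have overlap: "(\<Sum>(F, G)\<in>{(F, G) \<in> \<F>2 \<times> \<F>2. F \<inter> G \<noteq> {}}. \<sigma> ^ card (F \<union> G))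
          \<le> real m * (\<mu>\<^sup>2 * \<kappa>\<^sup>2) + real m * (\<mu>\<^sup>2 * \<kappa> ^ 3)" .
      have "(real (card \<F>2))\<^sup>2 * (\<sigma> ^ 4 - \<rho> ^ 4) \<le> (real m * (real T)\<^sup>2 / 2)\<^sup>2 * (\<sigma> ^ 4 - \<rho> ^ 4)"
        using card\<F>2(2) \<open>\<rho> \<le> \<sigma>\<close> \<rho> by (intro mult_right_mono power_mono) (auto intro: power_mono)
      also have "\<dots> = (real m)\<^sup>2 * \<mu> ^ 4 / 4 * (\<kappa> ^ 4 - 1)"
        unfolding \<sigma>eq \<mu> by (simp add: power_mult_distrib algebra_simps power_divide flip: power_mult)
      also have "\<dots> \<le> (real m)\<^sup>2 * \<mu>\<^sup>2 * (\<kappa> ^ 4 - 1)"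
      proof (rule mult_right_mono)
        have "\<mu> ^ 4 \<le> \<mu>\<^sup>2" using \<open>0 < \<mu>\<close> \<open>\<mu> \<le> 1 / 2\<close> by (intro power_decreasing) auto
        then have "(real m)\<^sup>2 * \<mu> ^ 4 \<le> (real m)\<^sup>2 * \<mu>\<^sup>2" by (intro mult_left_mono) auto
        moreover have "0 \<le> (real m)\<^sup>2 * \<mu>\<^sup>2" by simp
        ultimately show "(real m)\<^sup>2 * \<mu> ^ 4 / 4 \<le> (real m)\<^sup>2 * \<mu>\<^sup>2" by linarith
        show "0 \<le> \<kappa> ^ 4 - 1" using \<kappa> by simp
      qed
      finally have main: "(real (card \<F>2))\<^sup>2 * (\<sigma> ^ 4 - \<rho> ^ 4) \<le> (real m)\<^sup>2 * \<mu>\<^sup>2 * (\<kappa> ^ 4 - 1)" .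
      have "64 * ((\<kappa> ^ 4 - 1) + (\<kappa>\<^sup>2 + \<kappa> ^ 3) / real m) * (real m * \<mu> / 8)\<^sup>2
          = (real m)\<^sup>2 * \<mu>\<^sup>2 * (\<kappa> ^ 4 - 1) + (real m * (\<mu>\<^sup>2 * \<kappa>\<^sup>2) + real m * (\<mu>\<^sup>2 * \<kappa> ^ 3))"
        using \<open>m > 0\<close> by (simp add: field_simps power2_eq_square)
      then show "(real (card \<F>2))\<^sup>2 * (\<sigma> ^ (2 * 2) - \<rho> ^ (2 * 2))
        + (\<Sum>(F, G)\<in>{(F, G) \<in> \<F>2 \<times> \<F>2. F \<inter> G \<noteq> {}}. \<sigma> ^ card (F \<union> G))
        \<le> 64 * ((\<kappa> ^ 4 - 1) + (\<kappa>\<^sup>2 + \<kappa> ^ 3) / real m) * (real m * \<mu> / 8)\<^sup>2"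
        using main overlap by simp
    qed simp
    finally show ?thesis
      using \<open>0 < \<mu>\<close> \<open>m > 0\<close> by (simp flip: mult.assoc)
  qed

  have "\<exists>L. is_line M L \<and> real m * \<mu> / 8 \<le> real (card L)"
    if M: "M \<in> \<Omega>" "M \<notin> bad1" "M \<notin> bad2" for M
  proof -
    have "finite M" "disjoint M"
      using M(1) finite_UnionD[of M] by (simp_all add: \<Omega>_def ordered_matchings_def)
    then obtain L where L: "is_line M L" "card (M \<inter> (\<Union>i<m. E i))
        \<le> card L + card {F. (\<exists>i<m. F \<subseteq> E i) \<and> card F = 2 \<and> disjoint F \<and> F \<subseteq> M}"
      using line_from_blocks[of M m E t] E_edge by blast
    have "{F \<in> \<F>1. F \<subseteq> M} = (\<lambda>e. {e}) ` (M \<inter> (\<Union>i<m. E i))" by (auto simp: \<F>1_def)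
    then have "card (M \<inter> (\<Union>i<m. E i)) = X M"
      by (simp add: X_def card_image inj_on_def)
    moreover have "{F. (\<exists>i<m. F \<subseteq> E i) \<and> card F = 2 \<and> disjoint F \<and> F \<subseteq> M} = {F \<in> \<F>2. F \<subseteq> M}"
      by (auto simp: \<F>2_def)
    ultimately have "real (X M) \<le> real (card L) + real (Z M)"
      using L(2) by (simp add: Z_def flip: of_nat_add)
    moreover have "real m * \<mu> / 2 < real (X M)"
    proof -
      have "real (card \<F>1) * \<rho> ^ 1 = real m * \<mu>" by (simp add: card\<F>1 \<mu>)
      then have "\<bar>real (X M) - real m * \<mu>\<bar> < real m * \<mu> / 2"
        using M by (simp add: bad1_def)
      then show ?thesis by linarith
    qed
    moreover have "real (Z M) < 3 * (real m * \<mu>) / 8"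
    proof -
      have "real (card \<F>2) * \<rho> ^ 2 \<le> real m * (real T)\<^sup>2 / 2 * \<rho> ^ 2"
        using card\<F>2(2) by (intro mult_right_mono) auto
      also have "\<dots> = real m * \<mu> * \<mu> / 2" by (simp add: \<mu> power2_eq_square)
      also have "\<dots> \<le> real m * \<mu> * (1 / 2) / 2"
        using \<open>0 < \<mu>\<close> \<open>\<mu> \<le> 1 / 2\<close> by (intro divide_right_mono mult_left_mono) auto
      finally have "real (card \<F>2) * \<rho> ^ 2 \<le> real m * \<mu> / 4" by simp
      moreover have "\<bar>real (Z M) - real (card \<F>2) * \<rho> ^ 2\<bar> < real m * \<mu> / 8"
        using M by (simp add: bad2_def)
      ultimately show ?thesis by linarith
    qed
    ultimately have "real m * \<mu> / 8 \<le> real (card L)" by linarith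
    then show ?thesis using L(1) by blast
  qed
  then have "{M \<in> \<Omega>. \<nexists>L. is_line M L \<and> real m * \<mu> / 8 \<le> real (card L)} \<subseteq> bad1 \<union> bad2"
    by blast
  then have "card {M \<in> \<Omega>. \<nexists>L. is_line M L \<and> real m * \<mu> / 8 \<le> real (card L)} \<le> card (bad1 \<union> bad2)"
    using fin\<Omega> by (intro card_mono) (auto simp: bad1_def bad2_def)
  also have "\<dots> \<le> card bad1 + card bad2" by (rule card_Un_le)
  finally have "real (card {M \<in> \<Omega>. \<nexists>L. is_line M L \<and> real m * \<mu> / 8 \<le> real (card L)})
      \<le> real (card bad1) + real (card bad2)"
    by (simp flip: of_nat_add)
  with bad1 bad2 show ?thesis
    unfolding \<Omega>_def[symmetric] distrib_left[of "real (card \<Omega>)"] by linarith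
qed

subsection \<open>Asymptotics\<close>

text \<open>Both coefficients are products of \<open>k\<close> fractions with the same denominators
  \<open>k - i\<close>, so it suffices to compare numerators factor by factor.\<close>

lemma binomial_ratio_le:
  fixes q :: real
  assumes "k \<le> a" "k \<le> b" "\<And>i. i < k \<Longrightarrow> real (a - i) \<le> q * real (b - i)"
  shows "real (a choose k) \<le> q ^ k * real (b choose k)"
proof -
  have "real (a choose k) = (\<Prod>i = 0..<k. real (a - i) / real (k - i))"
    using assms(1) by (rule binomial_altdef_of_nat)
  also have "\<dots> \<le> (\<Prod>i = 0..<k. q * (real (b - i) / real (k - i)))"
    using assms(3) by (intro prod_mono) (auto simp: divide_right_mono)
  also have "\<dots> = q ^ k * (\<Prod>i = 0..<k. real (b - i) / real (k - i))"
    by (simp only: prod.distrib) simp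
  also have "(\<Prod>i = 0..<k. real (b - i) / real (k - i)) = real (b choose k)"
    using assms(2) by (rule binomial_altdef_of_nat[symmetric])
  finally show ?thesis .
qed

text \<open>This ratio is \<open>\<kappa>\<close>: a shift of \<open>n\<close> by a constant changes
  each of the \<open>r - 1\<close> factors by a ratio tending to 1.\<close>

lemma tendsto_shifted_binomial_ratio:
  assumes "r > 0"
  shows "(\<lambda>n. real ((r * n - 1) choose (r - 1)) / real ((r * (n - 3) - 1) choose (r - 1))) \<longlonglongrightarrow> 1"
proof (rule tendsto_sandwich)
  have pos: "r - 1 \<le> r * (n - 3) - 1" if "n \<ge> 5" for n
    using that by (intro pred_le_mult_pred) linarith
  show "\<forall>\<^sub>F n in sequentially. 1 \<le> real ((r * n - 1) choose (r - 1)) / real ((r * (n - 3) - 1) choose (r - 1))"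
  proof (rule eventually_mono[OF eventually_ge_at_top[of 5]])
    fix n :: nat assume "n \<ge> 5"
    have "(r * (n - 3) - 1) choose (r - 1) \<le> (r * n - 1) choose (r - 1)"
      by (intro binomial_right_mono diff_le_mono mult_le_mono2) auto
    then show "1 \<le> real ((r * n - 1) choose (r - 1)) / real ((r * (n - 3) - 1) choose (r - 1))"
      using pos[OF \<open>n \<ge> 5\<close>] by simp
  qed
  show "\<forall>\<^sub>F n in sequentially. real ((r * n - 1) choose (r - 1)) / real ((r * (n - 3) - 1) choose (r - 1))
      \<le> (real n / (real n - 4)) ^ (r - 1)"
  proof (rule eventually_mono[OF eventually_ge_at_top[of 5]])
    fix n :: nat assume n: "n \<ge> 5"
    have "real ((r * n - 1) choose (r - 1))
        \<le> (real n / (real n - 4)) ^ (r - 1) * real ((r * (n - 3) - 1) choose (r - 1))"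
    proof (rule binomial_ratio_le)
      show "r - 1 \<le> r * n - 1" using n by (intro pred_le_mult_pred) linarith
      show "r - 1 \<le> r * (n - 3) - 1" by (rule pos[OF n])
      fix i assume i: "i < r - 1"
      have "r * 1 \<le> r * (n - 3)" using n by (intro mult_le_mono2) simp
      then have "1 + i \<le> r * (n - 3)" using i by linarith
      moreover have "r * (n - 3) \<le> r * n" by simp
      ultimately have le: "1 + i \<le> r * (n - 3)" "1 + i \<le> r * n" by linarith+
      have eq: "real (r * n - 1 - i) = real r * real n - (1 + real i)"
        "real (r * (n - 3) - 1 - i) = real r * (real n - 3) - (1 + real i)"
        using le n by (simp_all add: of_nat_diff)
      \<comment> \<open>After clearing denominators, the factor comparison is exactly this
        inequality. The denominator \<open>n - 4\<close>, instead of \<open>n - 3\<close>, gives the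
        slack that absorbs the offsets \<open>1 + i\<close>.\<close>
      have "4 * (1 + real i) \<le> real n * real r"
        using n i by (intro mult_mono) auto
      then show "real (r * n - 1 - i) \<le> real n / (real n - 4) * real (r * (n - 3) - 1 - i)"
        unfolding eq using n by (simp add: field_simps)
    qed
    then show "real ((r * n - 1) choose (r - 1)) / real ((r * (n - 3) - 1) choose (r - 1))
        \<le> (real n / (real n - 4)) ^ (r - 1)"
      using pos[OF n] by (simp add: pos_divide_le_eq)
  qed
  have "(\<lambda>n. real n / (real n - 4)) \<longlonglongrightarrow> 1" by real_asymp
  from tendsto_power[OF this, of "r - 1"]
  show "(\<lambda>n. (real n / (real n - 4)) ^ (r - 1)) \<longlonglongrightarrow> 1" by simp
qed simp

text \<open>The \<open>r\<close>-th power of \<open>n powr (1 - 1 / r)\<close> is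
  \<open>n ^ (r - 1)\<close>, the order of the binomial coefficient in the denominator, so
  \<open>\<mu>\<close> has constant order. Standard power bounds on both binomial coefficients give
  the constants.\<close>

lemma block_density_bounds:
  fixes r n t :: nat
  assumes "r \<ge> 2" "n > 0" "r \<le> t"
    and "real t \<le> real n powr (1 - 1 / real r)" "real n powr (1 - 1 / real r) \<le> 2 * real t"
  defines "\<mu> \<equiv> real (t choose r) * (1 / real ((r * n - 1) choose (r - 1)))"
  shows "(1 / (2 * real r)) ^ r / real r ^ (r - 1) \<le> \<mu>" and "\<mu> \<le> 1 / 2"
proof -
  define y where "y = real n powr (1 - 1 / real r)"
  have "y ^ r = real n powr ((1 - 1 / real r) * real r)"
    using assms(2) by (simp add: y_def powr_powr flip: powr_realpow)
  also have "(1 - 1 / real r) * real r = real (r - 1)"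
    using assms(1) by (simp add: field_simps of_nat_diff)
  finally have y: "y ^ r = real n ^ (r - 1)"
    using assms(2) by (simp add: powr_realpow)
  have k: "r - 1 \<le> r * n - 1" using assms(2) by (rule pred_le_mult_pred)
  then have pos: "real ((r * n - 1) choose (r - 1)) > 0" by simp

  have "real n ^ (r - 1) * (1 / (2 * real r)) ^ r = (y / (2 * real r)) ^ r"
    by (simp add: power_divide y)
  also have "\<dots> \<le> (real t / real r) ^ r"
    using assms(1,5) by (intro power_mono) (auto simp: y_def field_simps)
  also have "\<dots> \<le> real (t choose r)"
    using assms(3) by (rule binomial_ge_n_over_k_pow_k)
  finally have T: "real n ^ (r - 1) * (1 / (2 * real r)) ^ r \<le> real (t choose r)" .
  have "(r * n - 1) choose (r - 1) \<le> (r * n - 1) ^ (r - 1)" by (rule binomial_le_pow[OF k])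
  also have "\<dots> \<le> (r * n) ^ (r - 1)" by (rule power_mono) auto
  finally have "real ((r * n - 1) choose (r - 1)) \<le> real ((r * n) ^ (r - 1))" by (rule of_nat_mono)
  then have C: "real ((r * n - 1) choose (r - 1)) \<le> real r ^ (r - 1) * real n ^ (r - 1)"
    by (simp add: power_mult_distrib)
  have "(1 / (2 * real r)) ^ r / real r ^ (r - 1)
      = (real n ^ (r - 1) * (1 / (2 * real r)) ^ r) / (real r ^ (r - 1) * real n ^ (r - 1))"
    using assms(2) by simp
  also have "\<dots> \<le> real (t choose r) / real ((r * n - 1) choose (r - 1))"
    using T C pos by (intro frac_le) simp_all
  finally show "(1 / (2 * real r)) ^ r / real r ^ (r - 1) \<le> \<mu>" by (simp add: \<mu>_def)

  have "real ((t choose r) * fact r) \<le> real (t ^ r)" by (intro of_nat_mono binomial_fact_pow)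
  then have "real (t choose r) * fact r \<le> real t ^ r" by simp
  also have "\<dots> \<le> y ^ r" using assms(4) by (intro power_mono) (auto simp: y_def)
  finally have "real (t choose r) * fact r \<le> real n ^ (r - 1)" by (simp only: y)
  \<comment> \<open>The bound \<open>1 / 2\<close> on \<open>\<mu>\<close> stems from
    \<open>r! \<ge> 2\<close>.\<close>
  moreover have "(2::real) \<le> fact r" using fact_mono[of 2 r, where 'a = real] assms(1) by simp
  then have "real (t choose r) * 2 \<le> real (t choose r) * fact r" by (intro mult_left_mono) auto
  moreover have "real n ^ (r - 1) \<le> (real (r * n - 1) / real (r - 1)) ^ (r - 1)"
  proof (rule power_mono)
    have "n * (r - 1) = r * n - n" by (simp add: diff_mult_distrib2 mult.commute)
    also have "\<dots> \<le> r * n - 1" using assms(2) by (intro diff_le_mono2) simp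
    finally have "real n * real (r - 1) \<le> real (r * n - 1)"
      by (metis of_nat_le_iff of_nat_mult)
    then show "real n \<le> real (r * n - 1) / real (r - 1)"
      using assms(1) by (simp add: pos_le_divide_eq)
  qed simp
  moreover have "(real (r * n - 1) / real (r - 1)) ^ (r - 1) \<le> real ((r * n - 1) choose (r - 1))"
    by (rule binomial_ge_n_over_k_pow_k[OF k])
  ultimately have "real (t choose r) * 2 \<le> real ((r * n - 1) choose (r - 1))" by linarith
  then show "\<mu> \<le> 1 / 2" using pos by (simp add: \<mu>_def field_simps)
qed

section \<open>Choice of parameters and passage to the limit\<close>

theorem theoremC1:
  fixes r :: nat
  assumes "r \<ge> 2"
  shows "\<exists>c::real. c > 0 \<and>
    (\<lambda>n. measure_pmf.prob (pmf_of_set (ordered_matchings r n))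
        {M. \<exists>L. is_line M L \<and> real (card L) \<ge> c * real n powr (1 / real r)})
      \<longlonglongrightarrow> 1"
proof -
  define \<mu>0 where "\<mu>0 = (1 / (2 * real r)) ^ r / real r ^ (r - 1)"
  define m where "m n = nat \<lfloor>real n powr (1 / real r)\<rfloor>" for n
  define t where "t n = nat \<lfloor>real n powr (1 - 1 / real r)\<rfloor>" for n
  define \<kappa> where "\<kappa> n = real ((r * n - 1) choose (r - 1)) / real ((r * (n - 3) - 1) choose (r - 1))" for n
  \<comment> \<open>The constant \<open>\<mu>0\<close> stands in for the density
    \<open>\<mu>\<close>, which varies with \<open>n\<close>.\<close>
  define err where "err n = 4 * (((\<kappa> n)\<^sup>2 - 1) + \<kappa> n / (real (m n) * \<mu>0))
    + 64 * (((\<kappa> n) ^ 4 - 1) + ((\<kappa> n)\<^sup>2 + (\<kappa> n) ^ 3) / real (m n))" for n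
  \<comment> \<open>The constant is \<open>\<mu>0 / 16\<close>: a factor 8 is lost in the line
    length and a factor 2 in rounding \<open>n powr (1 / r)\<close> down to
    \<open>m n\<close>.\<close>
  define p where "p n = measure_pmf.prob (pmf_of_set (ordered_matchings r n))
        {M. \<exists>L. is_line M L \<and> real (card L) \<ge> \<mu>0 / 16 * real n powr (1 / real r)}" for n
  have "\<mu>0 > 0" using assms by (simp add: \<mu>0_def)
  have lim_x: "filterlim (\<lambda>n. real n powr (1 / real r)) at_top sequentially"
    using assms by (intro filterlim_compose[OF real_powr_at_top filterlim_real_sequentially]) auto
  have lim_y: "filterlim (\<lambda>n. real n powr (1 - 1 / real r)) at_top sequentially"
    using assms by (intro filterlim_compose[OF real_powr_at_top filterlim_real_sequentially]) auto
  have floor: "real (nat \<lfloor>x\<rfloor>) \<le> x" "x \<le> 2 * real (nat \<lfloor>x\<rfloor>)" if "x \<ge> 2" for x :: real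
    using that by linarith+

  \<comment> \<open>The threshold \<open>r + 2\<close> guarantees \<open>r \<le> t n\<close> after
    rounding and is large enough for \<open>floor\<close> to apply.\<close>
  have bound: "1 - err n \<le> p n" if n: "n \<ge> 4" "real n powr (1 / real r) \<ge> 2"
    "real n powr (1 - 1 / real r) \<ge> real r + 2" for n
  proof -
    let ?\<Omega> = "ordered_matchings r n"
    define \<mu> where "\<mu> = real (t n choose r) * (1 / real ((r * n - 1) choose (r - 1)))"
    define A where "A = {M. \<exists>L. is_line M L \<and> real (card L) \<ge> \<mu>0 / 16 * real n powr (1 / real r)}"
    have m: "real (m n) \<le> real n powr (1 / real r)" "real n powr (1 / real r) \<le> 2 * real (m n)"
      unfolding m_def using n(2) by (intro floor; simp)+
    have t: "real (t n) \<le> real n powr (1 - 1 / real r)" "real n powr (1 - 1 / real r) \<le> 2 * real (t n)"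
      unfolding t_def using n(3) by (intro floor; simp)+
    have "r \<le> t n" unfolding t_def using n(3) by linarith
    have "m n > 0" using m(2) n(2) by (cases "m n = 0") auto
    have \<mu>: "\<mu>0 \<le> \<mu>" "\<mu> \<le> 1 / 2"
      using block_density_bounds[OF assms _ \<open>r \<le> t n\<close> t] n(1) by (simp_all add: \<mu>0_def \<mu>_def)
    \<comment> \<open>The exponents \<open>1 / r\<close> and \<open>1 - 1 / r\<close> add up to 1,
      so all blocks fit into the first \<open>n\<close> of the \<open>r * n\<close>
      vertices.\<close>
    have "real (m n) * real (t n) \<le> real n powr (1 / real r) * real n powr (1 - 1 / real r)"
      by (intro mult_mono m t) auto
    also have "\<dots> = real n" using n(1) by (simp flip: powr_add)
    finally have "real (m n * t n) \<le> real n" by simp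
    then have "m n * t n \<le> 1 * n" by (simp only: of_nat_le_iff mult_1)
    also have "\<dots> \<le> r * n" using assms by (intro mult_right_mono) auto
    finally have "m n * t n \<le> r * n" .
    have "\<kappa> n \<ge> 0" by (simp add: \<kappa>_def)

    have "real (card {M \<in> ?\<Omega>. \<nexists>L. is_line M L \<and> real (m n) * \<mu> / 8 \<le> real (card L)})
      \<le> real (card ?\<Omega>) * (4 * (((\<kappa> n)\<^sup>2 - 1) + \<kappa> n / (real (m n) * \<mu>))
        + 64 * (((\<kappa> n) ^ 4 - 1) + ((\<kappa> n)\<^sup>2 + (\<kappa> n) ^ 3) / real (m n)))"
      using card_matchings_without_line_le[of r n "m n" "t n"] assms n(1) \<open>m n * t n \<le> r * n\<close> \<open>m n > 0\<close> \<mu> \<open>\<mu>0 > 0\<close>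
      by (simp add: \<mu>_def \<kappa>_def)
    \<comment> \<open>The density occurs only in a denominator, so replacing it by its lower bound
      \<open>\<mu>0\<close> enlarges the error.\<close>
    also have "\<dots> \<le> real (card ?\<Omega>) * err n"
      unfolding err_def using \<mu>(1) \<open>\<mu>0 > 0\<close> \<open>m n > 0\<close> \<open>\<kappa> n \<ge> 0\<close>
      by (intro mult_left_mono add_mono divide_left_mono order_refl) auto
    finally have bad: "real (card {M \<in> ?\<Omega>. \<nexists>L. is_line M L \<and> real (m n) * \<mu> / 8 \<le> real (card L)})
      \<le> real (card ?\<Omega>) * err n" .
    have "real n powr (1 / real r) * \<mu>0 \<le> 2 * real (m n) * \<mu>"
      using m \<mu> \<open>\<mu>0 > 0\<close> by (intro mult_mono) auto
    then have "\<mu>0 / 16 * real n powr (1 / real r) \<le> real (m n) * \<mu> / 8" by (simp add: mult.commute)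
    then have "?\<Omega> - A \<subseteq> {M \<in> ?\<Omega>. \<nexists>L. is_line M L \<and> real (m n) * \<mu> / 8 \<le> real (card L)}"
      unfolding A_def by (auto intro: order_trans)
    then have "card (?\<Omega> - A) \<le> card {M \<in> ?\<Omega>. \<nexists>L. is_line M L \<and> real (m n) * \<mu> / 8 \<le> real (card L)}"
      by (intro card_mono) (simp_all add: finite_ordered_matchings)
    then have compl: "real (card (?\<Omega> - A)) \<le> real (card ?\<Omega>) * err n" using bad by linarith
    have "card ?\<Omega> = card (?\<Omega> \<inter> A) + card (?\<Omega> - A)"
      using card_Int_Diff[OF finite_ordered_matchings] .
    then have "real (card ?\<Omega>) * (1 - err n) \<le> real (card (?\<Omega> \<inter> A))"
      using compl by (simp add: algebra_simps)
    moreover have ne: "?\<Omega> \<noteq> {}" using ordered_matchings_nonempty assms by simp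
    then have "card ?\<Omega> > 0" using finite_ordered_matchings by (simp add: card_gt_0_iff)
    moreover have "p n = real (card (?\<Omega> \<inter> A)) / real (card ?\<Omega>)"
      unfolding p_def A_def using ne finite_ordered_matchings by (rule measure_pmf_of_set)
    ultimately show ?thesis by (simp add: pos_le_divide_eq mult.commute)
  qed
  have ev: "\<forall>\<^sub>F n in sequentially. 1 - err n \<le> p n"
    using eventually_ge_at_top[of 4] lim_x[unfolded filterlim_at_top, rule_format, of 2]
      lim_y[unfolded filterlim_at_top, rule_format, of "real r + 2"]
    by eventually_elim (rule bound)

  have lim_m: "filterlim (\<lambda>n. real (m n)) at_top sequentially"
    unfolding m_def
    by (intro filterlim_compose[OF filterlim_real_sequentially]
      filterlim_compose[OF filterlim_nat_sequentially] filterlim_compose[OF filterlim_floor_sequentially lim_x])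
  have inf_m: "filterlim (\<lambda>n. real (m n)) at_infinity sequentially"
    by (rule filterlim_at_top_imp_at_infinity[OF lim_m])
  have inf_m\<mu>: "filterlim (\<lambda>n. real (m n) * \<mu>0) at_infinity sequentially"
    using \<open>\<mu>0 > 0\<close> by (intro filterlim_at_top_imp_at_infinity
      filterlim_at_top_mult_tendsto_pos[OF tendsto_const _ lim_m])
  have \<kappa>: "\<kappa> \<longlonglongrightarrow> 1"
    unfolding \<kappa>_def using assms by (intro tendsto_shifted_binomial_ratio) simp
  \<comment> \<open>The terms in \<open>\<kappa>\<close> alone vanish as \<open>\<kappa>\<close>
    tends to 1, and the quotients vanish because their numerators converge while \<open>m\<close>
    tends to infinity.\<close>
  have "(\<lambda>n. 1 - err n) \<longlonglongrightarrow> 1 - (4 * ((1\<^sup>2 - 1) + 0) + 64 * ((1 ^ 4 - 1) + 0))"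
    unfolding err_def
    by (intro tendsto_intros \<kappa> tendsto_divide_0[OF \<kappa> inf_m\<mu>]
      tendsto_divide_0[OF tendsto_add[OF tendsto_power[OF \<kappa>] tendsto_power[OF \<kappa>]] inf_m])
  then have "(\<lambda>n. 1 - err n) \<longlonglongrightarrow> 1" by simp
  moreover have "\<forall>\<^sub>F n in sequentially. p n \<le> 1" by (simp add: p_def)
  ultimately have "p \<longlonglongrightarrow> 1"
    using ev tendsto_const by (intro tendsto_sandwich[of "\<lambda>n. 1 - err n" p _ "\<lambda>_. 1"])
  then show ?thesis
    using \<open>\<mu>0 > 0\<close> unfolding p_def by (intro exI[of _ "\<mu>0 / 16"]) simp
qed

end
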